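(* There exists an absolute constant $C$ such that the following holds for any monotone Boolean function $f:\{0,1\}^n\to\{0,1\}$ with critical probability $p_c$ and any $p \le p_c$. Suppose that for some $M>0$ the function $f$ is $M$-global in the interval $[p,p_c]$ and that $\mu_p(f)\ge e^{-M/C}$. Then $p_c \le M^C p$.
   Context: For $q\in[0,1]$, $\mu_q$ is the $q$-biased product measure on $\{0,1\}^n$ and $\mu_q(f)=\mathbb{E}_{\mu_q}[f]$. $f$ is monotone if $f(x)\le f(y)$ whenever $x_i \le y_i$ for all $i$. The critical probability is $p_c=\inf\{q:\mu_q(f)\ge 1/2\}$. For $J\subseteq[n]$, $f_{J\to1}$ is the function on $\{0,1\}^{[n]\setminus J}$ obtained by setting the coordinates of $J$ to $1$. $f$ is $M$-global in an interval $I$ if for every $J\subseteq[n]$ with $|J|\le M$ and every $q\in I$ we have $\mu_q(f_{J\to1})\le \mu_q(f)^{0.01}$. *)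

theory Defs
  imports "HOL-Probability.Probability"
begin

text \<open>
  The coordinates of the cube over a finite set \<open>A\<close> of indices are encoded as
  \<open>True\<close> (for 1) and \<open>False\<close> (for 0). A point of the cube is a function that is \<open>False\<close> outside
  \<open>A\<close>; this is the convention of \<^const>\<open>Pi_pmf\<close>. A Boolean function on the cube is a predicate
  whose values outside the cube play no role.
\<close>

definition cube :: "nat set \<Rightarrow> (nat \<Rightarrow> bool) set" where
  "cube A = PiE_dflt A False (\<lambda>_. UNIV)"

definition biased :: "nat set \<Rightarrow> real \<Rightarrow> (nat \<Rightarrow> bool) pmf" where
  "biased A q = Pi_pmf A False (\<lambda>_. bernoulli_pmf q)"

definition mu :: "nat set \<Rightarrow> real \<Rightarrow> ((nat \<Rightarrow> bool) \<Rightarrow> bool) \<Rightarrow> real" where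
  "mu A q f = measure_pmf.expectation (biased A q) (\<lambda>x. of_bool (f x))"

definition monotone_boolean :: "nat set \<Rightarrow> ((nat \<Rightarrow> bool) \<Rightarrow> bool) \<Rightarrow> bool" where
  "monotone_boolean A f \<longleftrightarrow>
     (\<forall>x\<in>cube A. \<forall>y\<in>cube A. (\<forall>i\<in>A. x i \<le> y i) \<longrightarrow> f x \<le> f y)"

text \<open>
  For the constant function 0 the set below is empty and the value is unspecified.
\<close>

definition critical_prob :: "nat set \<Rightarrow> ((nat \<Rightarrow> bool) \<Rightarrow> bool) \<Rightarrow> real" where
  "critical_prob A f = Inf {q\<in>{0..1}. mu A q f \<ge> 1/2}"

text \<open>
  If \<open>f\<close> is a function on \<open>cube A\<close> and \<open>J \<subseteq> A\<close>, then \<open>set_ones J f\<close> is to be read as a function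
  on \<open>cube (A - J)\<close>.
\<close>

definition set_ones :: "nat set \<Rightarrow> ((nat \<Rightarrow> bool) \<Rightarrow> bool) \<Rightarrow> (nat \<Rightarrow> bool) \<Rightarrow> bool" where
  "set_ones J f = (\<lambda>x. f (\<lambda>i. if i \<in> J then True else x i))"

definition global_in :: "nat set \<Rightarrow> real \<Rightarrow> real set \<Rightarrow> ((nat \<Rightarrow> bool) \<Rightarrow> bool) \<Rightarrow> bool" where
  "global_in A M I f \<longleftrightarrow>
     (\<forall>J\<subseteq>A. real (card J) \<le> M \<longrightarrow>
        (\<forall>q\<in>I. mu (A - J) q (set_ones J f) \<le> mu A q f powr 0.01))"

end

theory Submission
  imports Defs
begin

text \<open>
  Expand \<open>f\<close> in the characters \<open>\<Prod>i\<in>S. (x i - q)\<close>, and let \<open>T\<close> multiply the coefficient at \<open>S\<close>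
  by \<open>4 ^ -|S|\<close>. Put \<open>\<mu> = \<mu>\<^sub>q(f)\<close>, \<open>v = q (1 - q)\<close> and let \<open>I\<close> be the total influence. The coefficients
  distribute the mass \<open>\<mu>\<close> with mean degree \<open>K = v I / \<mu>\<close>, so convexity gives \<open>E[f Tf] \<ge> 4 powr -K * \<mu>\<close>.
  Conversely \<open>E[f Tf]^4 \<le> \<mu>^3 E[(Tf)^4]\<close>, and a hypercontractive inequality, proved one coordinate
  at a time, bounds \<open>E[(Tf)^4]\<close> by the norms of the discrete derivatives of \<open>f\<close>, which for a
  monotone global function are small enough to give \<open>E[(Tf)^4] \<le> \<mu> powr 0.01 * \<mu>\<close>. Hence
  \<open>q I \<ge> \<mu> ln (1/\<mu>) / 1000\<close> on \<open>[p, pc]\<close>, and since \<open>I\<close> is the derivative of \<open>\<mu>\<close> in \<open>q\<close>,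
  \<open>ln ln (1/\<mu>) + ln q / 1000\<close> is nonincreasing there.
\<close>

section \<open>Biased expectations and character expansions\<close>

text \<open>A point of the cube is encoded by the set of its coordinates equal to 1. As an explicit
  polynomial in \<open>q\<close> the expectation can be differentiated at every real
  \<open>q\<close>, endpoints included.\<close>

definition expect :: "'a set \<Rightarrow> real \<Rightarrow> ('a set \<Rightarrow> real) \<Rightarrow> real" where
  "expect A q g = (\<Sum>X\<in>Pow A. q ^ card X * (1 - q) ^ card (A - X) * g X)"

text \<open>The biased Fourier character without its normalisation: nothing is divided by the square
  root of \<open>q * (1 - q)\<close>, so \<open>q = 0\<close> and \<open>q = 1\<close> are not
  exceptional.\<close>

definition chr :: "real \<Rightarrow> 'a set \<Rightarrow> 'a set \<Rightarrow> real" where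
  "chr q S X = (\<Prod>i\<in>S. of_bool (i \<in> X) - q)"

definition expansion :: "'a set \<Rightarrow> real \<Rightarrow> ('a set \<Rightarrow> real) \<Rightarrow> 'a set \<Rightarrow> real" where
  "expansion A q a X = (\<Sum>S\<in>Pow A. a S * chr q S X)"

lemma sum_Pow_insert:
  fixes h :: "'a set \<Rightarrow> real"
  assumes "finite A" "i \<notin> A"
  shows "(\<Sum>S\<in>Pow (insert i A). h S) = (\<Sum>S\<in>Pow A. h S) + (\<Sum>S\<in>Pow A. h (insert i S))"
proof -
  have "inj_on (insert i) (Pow A)"
    using assms by (auto simp: inj_on_def)
  moreover have "Pow A \<inter> insert i ` Pow A = {}"
    using assms by auto
  ultimately show ?thesis
    using assms by (simp add: Pow_insert sum.union_disjoint sum.reindex)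
qed

lemma expect_empty [simp]: "expect {} q g = g {}"
  by (simp add: expect_def)

lemma expect_insert:
  assumes "finite A" "i \<notin> A"
  shows "expect (insert i A) q g = (1 - q) * expect A q g + q * expect A q (\<lambda>X. g (insert i X))"
proof -
  have 1: "card (insert i A - X) = Suc (card (A - X))" if "X \<subseteq> A" for X
  proof -
    have "insert i A - X = insert i (A - X)" using that assms by auto
    then show ?thesis using assms by simp
  qed
  have 2: "A - insert i X = A - X" if "X \<subseteq> A" for X using that assms by auto
  have 3: "card (insert i X) = Suc (card X)" if "X \<subseteq> A" for X
    using that assms by (meson card_insert_disjoint finite_subset subsetD)
  show ?thesis
    unfolding expect_def sum_Pow_insert[OF assms] sum_distrib_left
    by (intro arg_cong2[where f = "(+)"] sum.cong) (use assms in \<open>simp_all add: 1 2 3\<close>)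
qed

lemma expect_cong: "(\<And>X. X \<subseteq> A \<Longrightarrow> g X = h X) \<Longrightarrow> expect A q g = expect A q h"
  unfolding expect_def by (intro sum.cong) auto

lemma expect_mono:
  assumes "0 \<le> q" "q \<le> 1" "\<And>X. X \<subseteq> A \<Longrightarrow> g X \<le> h X"
  shows "expect A q g \<le> expect A q h"
  unfolding expect_def using assms by (intro sum_mono mult_left_mono) auto

lemma expect_add: "expect A q (\<lambda>X. g X + h X) = expect A q g + expect A q h"
  by (simp add: expect_def algebra_simps sum.distrib)

lemma expect_cmult: "expect A q (\<lambda>X. c * g X) = c * expect A q g"
  by (simp add: expect_def algebra_simps sum_distrib_left)

lemma expect_diff: "expect A q (\<lambda>X. g X - h X) = expect A q g - expect A q h"
  by (simp add: expect_def algebra_simps sum_subtractf)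

lemma expect_nonneg:
  "0 \<le> q \<Longrightarrow> q \<le> 1 \<Longrightarrow> (\<And>X. X \<subseteq> A \<Longrightarrow> 0 \<le> g X) \<Longrightarrow> 0 \<le> expect A q g"
  unfolding expect_def by (intro sum_nonneg) auto

lemma expect_const: "finite A \<Longrightarrow> expect A q (\<lambda>_. c) = c"
  by (induction A rule: finite_induct) (simp_all add: expect_insert algebra_simps)

lemma expect_Cauchy_Schwarz:
  assumes "0 \<le> q" "q \<le> 1"
  shows "(expect A q (\<lambda>X. g X * h X))\<^sup>2 \<le> expect A q (\<lambda>X. (g X)\<^sup>2) * expect A q (\<lambda>X. (h X)\<^sup>2)"
proof -
  define w where "w X = sqrt (q ^ card X * (1 - q) ^ card (A - X))" for X
  have w: "q ^ card X * (1 - q) ^ card (A - X) = w X * w X" for X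
    using assms by (simp add: w_def)
  have "(\<Sum>X\<in>Pow A. (w X * g X) * (w X * h X))\<^sup>2
      \<le> (\<Sum>X\<in>Pow A. (w X * g X)\<^sup>2) * (\<Sum>X\<in>Pow A. (w X * h X)\<^sup>2)"
    by (rule Cauchy_Schwarz_ineq_sum)
  then show ?thesis
    by (simp add: expect_def w power2_eq_square mult_ac)
qed

lemma chr_insert_set:
  "finite S \<Longrightarrow> i \<notin> S \<Longrightarrow> chr q (insert i S) X = (of_bool (i \<in> X) - q) * chr q S X"
  by (simp add: chr_def)

lemma chr_insert_point: "i \<notin> S \<Longrightarrow> chr q S (insert i X) = chr q S X"
  unfolding chr_def by (intro prod.cong) auto

lemma expansion_insert:
  assumes "finite A" "i \<notin> A"
  shows "expansion (insert i A) q a X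
    = expansion A q a X + (of_bool (i \<in> X) - q) * expansion A q (\<lambda>S. a (insert i S)) X"
proof -
  have "chr q (insert i S) X = (of_bool (i \<in> X) - q) * chr q S X" if "S \<in> Pow A" for S
    using that assms by (intro chr_insert_set) (auto intro: finite_subset)
  then show ?thesis
    unfolding expansion_def sum_Pow_insert[OF assms] sum_distrib_left
    by (intro arg_cong2[where f = "(+)"] sum.cong refl) simp
qed

lemma expansion_insert_point:
  "i \<notin> A \<Longrightarrow> expansion A q a (insert i X) = expansion A q a X"
  unfolding expansion_def
  by (intro sum.cong refl arg_cong2[where f = "(*)"] chr_insert_point) auto

lemma expansion_cong:
  "(\<And>S. S \<subseteq> A \<Longrightarrow> a S = b S) \<Longrightarrow> expansion A q a X = expansion A q b X"
  unfolding expansion_def by (intro sum.cong) auto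

text \<open>In a single coordinate, f is its average plus \<open>of_bool (i \<in> X) - q\<close>
  times its difference. The average supplies the coefficients at sets without \<open>i\<close>, the
  difference those at sets containing \<open>i\<close>.\<close>

lemma expansion_exists:
  assumes "finite A"
  shows "\<exists>a. \<forall>X\<subseteq>A. f X = expansion A q a X"
  using assms
proof (induction A arbitrary: f rule: finite_induct)
  case empty
  show ?case by (intro exI[of _ f]) (simp add: expansion_def chr_def)
next
  case (insert i A)
  obtain a0 where a0: "\<And>X. X \<subseteq> A \<Longrightarrow> (1 - q) * f X + q * f (insert i X) = expansion A q a0 X"
    using insert.IH[of "\<lambda>X. (1 - q) * f X + q * f (insert i X)"] by blast
  obtain a1 where a1: "\<And>X. X \<subseteq> A \<Longrightarrow> f (insert i X) - f X = expansion A q a1 X"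
    using insert.IH[of "\<lambda>X. f (insert i X) - f X"] by blast
  define a where "a S = (if i \<in> S then a1 (S - {i}) else a0 S)" for S
  have e0: "expansion A q a Y = expansion A q a0 Y" for Y
    using insert.hyps by (intro expansion_cong) (auto simp: a_def)
  have e1: "expansion A q (\<lambda>S. a (insert i S)) Y = expansion A q a1 Y" for Y
    using insert.hyps by (intro expansion_cong) (auto simp: a_def insert_Diff_if intro!: arg_cong[where f = a1])
  have "f X = expansion (insert i A) q a X" if X: "X \<subseteq> insert i A" for X
  proof (cases "i \<in> X")
    case False
    then have "X \<subseteq> A" using X by auto
    then show ?thesis
      using False insert.hyps a0[of X] a1[of X]
      by (simp add: expansion_insert e0 e1 flip: a0 a1) (simp add: algebra_simps)
  next
    case True
    define Y where "Y = X - {i}"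
    have Y: "Y \<subseteq> A" "X = insert i Y" using X True by (auto simp: Y_def)
    show ?thesis
      using insert.hyps Y
      by (simp add: expansion_insert e0 e1 expansion_insert_point flip: a0 a1) (simp add: algebra_simps)
  qed
  then show ?case by blast
qed

text \<open>Parseval: in each coordinate x - q has mean 0, which kills the cross terms, and variance
  \<open>q * (1 - q)\<close>, which gives the weight.\<close>

lemma expect_expansion_mult:
  assumes "finite A"
  shows "expect A q (\<lambda>X. expansion A q a X * expansion A q b X)
    = (\<Sum>S\<in>Pow A. (q * (1 - q)) ^ card S * (a S * b S))"
  using assms
proof (induction A arbitrary: a b rule: finite_induct)
  case empty
  show ?case by (simp add: expansion_def chr_def)
next
  case (insert i A)
  let ?a1 = "\<lambda>S. a (insert i S)" and ?b1 = "\<lambda>S. b (insert i S)"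
  let ?e = "expansion A q"
  have card: "card (insert i S) = Suc (card S)" if "S \<in> Pow A" for S
    using that insert.hyps by (meson PowD card_insert_disjoint finite_subset subsetD)
  have "expect (insert i A) q (\<lambda>X. expansion (insert i A) q a X * expansion (insert i A) q b X)
    = (1 - q) * expect A q (\<lambda>X. (?e a X - q * ?e ?a1 X) * (?e b X - q * ?e ?b1 X))
      + q * expect A q (\<lambda>X. (?e a X + (1 - q) * ?e ?a1 X) * (?e b X + (1 - q) * ?e ?b1 X))"
    using insert.hyps
    by (subst expect_insert)
      (auto simp: expansion_insert expansion_insert_point
        intro!: arg_cong2[where f = "(+)"] arg_cong2[where f = "(*)"] expect_cong)
  also have "\<dots> = expect A q (\<lambda>X. ?e a X * ?e b X + (q * (1 - q)) * (?e ?a1 X * ?e ?b1 X))"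
    unfolding expect_cmult[symmetric] expect_add[symmetric]
    by (intro expect_cong) (simp add: algebra_simps)
  also have "\<dots> = (\<Sum>S\<in>Pow A. (q * (1 - q)) ^ card S * (a S * b S))
      + (q * (1 - q)) * (\<Sum>S\<in>Pow A. (q * (1 - q)) ^ card S * (?a1 S * ?b1 S))"
    unfolding expect_add expect_cmult insert.IH by simp
  also have "\<dots> = (\<Sum>S\<in>Pow (insert i A). (q * (1 - q)) ^ card S * (a S * b S))"
    unfolding sum_Pow_insert[OF insert.hyps] sum_distrib_left
    by (intro arg_cong2[where f = "(+)"] sum.cong refl) (simp add: card)
  finally show ?case .
qed

section \<open>Derivative norms and hypercontractivity\<close>

text \<open>
  With \<open>v = q (1 - q)\<close> this is the squared \<open>L\<^sup>2\<close> norm of the iterated discrete derivative in the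
  coordinates of \<open>R\<close>; \<open>chr q {i}\<close> has variance \<open>v\<close> and is deliberately not normalised.
\<close>

definition deriv_norm :: "'a set \<Rightarrow> real \<Rightarrow> ('a set \<Rightarrow> real) \<Rightarrow> 'a set \<Rightarrow> real" where
  "deriv_norm A v a R = (\<Sum>S\<in>Pow (A - R). v ^ card S * (a (S \<union> R))\<^sup>2)"

lemma deriv_norm_nonneg: "0 \<le> v \<Longrightarrow> 0 \<le> deriv_norm A v a R"
  unfolding deriv_norm_def by (intro sum_nonneg) auto

lemma deriv_norm_insert_in:
  assumes "i \<notin> A" "R \<subseteq> A"
  shows "deriv_norm (insert i A) v a (insert i R) = deriv_norm A v (\<lambda>S. a (insert i S)) R"
proof -
  have "insert i A - insert i R = A - R" using assms by auto
  then show ?thesis by (simp add: deriv_norm_def)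
qed

lemma deriv_norm_insert_notin:
  assumes "finite A" "i \<notin> A" "R \<subseteq> A"
  shows "deriv_norm (insert i A) v a R
    = deriv_norm A v a R + v * deriv_norm A v (\<lambda>S. a (insert i S)) R"
proof -
  have eq: "insert i A - R = insert i (A - R)" using assms by auto
  have card: "card (insert i S) = Suc (card S)" if "S \<in> Pow (A - R)" for S
    using that assms by (metis DiffE PowD card_insert_disjoint finite_Diff finite_subset subsetD)
  show ?thesis
    using assms
    by (simp add: deriv_norm_def eq sum_Pow_insert sum_distrib_left card mult_ac)
qed

definition noise :: "real \<Rightarrow> ('a set \<Rightarrow> real) \<Rightarrow> 'a set \<Rightarrow> real" where
  "noise r a S = r ^ card S * a S"

text \<open>The one-coordinate case of hypercontractivity with noise 1/2. Two functions are treated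
  at once because splitting off a coordinate turns even the fourth moment of one function into mixed
  products.\<close>

lemma two_point_inequality:
  fixes q :: real
  assumes "0 \<le> q" "q \<le> 1"
  shows "(1 - q) * ((f0 - q / 2 * f1)\<^sup>2 * (g0 - q / 2 * g1)\<^sup>2)
     + q * ((f0 + (1 - q) / 2 * f1)\<^sup>2 * (g0 + (1 - q) / 2 * g1)\<^sup>2)
   \<le> f0\<^sup>2 * g0\<^sup>2 + q * (1 - q) * (f0\<^sup>2 * g1\<^sup>2 + f1\<^sup>2 * g0\<^sup>2) + 3 / 16 * (q * (1 - q)) * (f1\<^sup>2 * g1\<^sup>2)"
proof -
  define v where "v = q * (1 - q)"
  have v: "0 \<le> v" using assms by (simp add: v_def)
  define s where "s = 1 - 2 * q"
  have s: "\<bar>s\<bar> \<le> 1" using assms by (auto simp: s_def)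
  \<comment> \<open>The second, third and fourth moments of x - q are \<open>v\<close>,
    \<open>v * s\<close> and \<open>v * (1 - 3 * v)\<close>.\<close>
  have quad: "(1 - q) * (u - q / 2 * w + (q / 2)\<^sup>2 * z)\<^sup>2 + q * (u + (1 - q) / 2 * w + ((1 - q) / 2)\<^sup>2 * z)\<^sup>2
    = u\<^sup>2 + v * ((w\<^sup>2 + 2 * (u * z)) / 4 + s * (w * z) / 4 + (1 - 3 * v) * z\<^sup>2 / 16)" for u w z
    unfolding v_def s_def by (simp add: field_simps power2_eq_square power3_eq_cube)
  have lhs: "(1 - q) * ((f0 - q / 2 * f1)\<^sup>2 * (g0 - q / 2 * g1)\<^sup>2)
     + q * ((f0 + (1 - q) / 2 * f1)\<^sup>2 * (g0 + (1 - q) / 2 * g1)\<^sup>2)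
   = f0\<^sup>2 * g0\<^sup>2 + v * ((f0\<^sup>2 * g1\<^sup>2 + f1\<^sup>2 * g0\<^sup>2 + 4 * ((f0 * g1) * (f1 * g0))) / 4
       + s * ((f0 * g1) * (f1 * g1) + (f1 * g0) * (f1 * g1)) / 4
       + (1 - 3 * v) * (f1\<^sup>2 * g1\<^sup>2) / 16)"
  proof -
    have sq: "(f0 + t * f1)\<^sup>2 * (g0 + t * g1)\<^sup>2
        = (f0 * g0 + t * (f0 * g1 + f1 * g0) + t\<^sup>2 * (f1 * g1))\<^sup>2" for t
      unfolding power_mult_distrib[symmetric] by (simp add: algebra_simps power2_eq_square)
    have w: "(f0 * g1 + f1 * g0)\<^sup>2 + 2 * (f0 * g0 * (f1 * g1))
        = f0\<^sup>2 * g1\<^sup>2 + f1\<^sup>2 * g0\<^sup>2 + 4 * ((f0 * g1) * (f1 * g0))"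
      by (simp add: algebra_simps power2_eq_square)
    show ?thesis
      using quad[of "f0 * g0" "f0 * g1 + f1 * g0" "f1 * g1"] sq[of "- (q / 2)"] sq[of "(1 - q) / 2"]
      unfolding w by (simp add: power_mult_distrib distrib_right)
  qed
  have a: "4 * (x * y) \<le> 2 * (x\<^sup>2 + y\<^sup>2)" for x y :: real
    using sum_squares_bound[of x y] by simp
  have b: "4 * (s * (x * y)) \<le> 4 * x\<^sup>2 + y\<^sup>2" for x y :: real
  proof -
    have "s * (x * y) \<le> \<bar>x * y\<bar>"
      using abs_ge_self[of "s * (x * y)"] mult_right_mono[OF s, of "\<bar>x * y\<bar>"] by (simp add: abs_mult)
    moreover have "4 * \<bar>x * y\<bar> \<le> 4 * x\<^sup>2 + y\<^sup>2"
      using sum_squares_bound[of "2 * \<bar>x\<bar>" "\<bar>y\<bar>"] by (simp add: abs_mult power_mult_distrib)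
    ultimately show ?thesis by linarith
  qed
  have c: "(1 - 3 * v) * (f1\<^sup>2 * g1\<^sup>2) \<le> f1\<^sup>2 * g1\<^sup>2"
    using v mult_right_mono[of "1 - 3 * v" 1 "f1\<^sup>2 * g1\<^sup>2"] by simp
  have "(f0\<^sup>2 * g1\<^sup>2 + f1\<^sup>2 * g0\<^sup>2 + 4 * ((f0 * g1) * (f1 * g0))) / 4
       + s * ((f0 * g1) * (f1 * g1) + (f1 * g0) * (f1 * g1)) / 4
       + (1 - 3 * v) * (f1\<^sup>2 * g1\<^sup>2) / 16
     \<le> f0\<^sup>2 * g1\<^sup>2 + f1\<^sup>2 * g0\<^sup>2 + 3 / 16 * (f1\<^sup>2 * g1\<^sup>2)"
  proof -
    \<comment> \<open>The budget: \<open>P\<close> and \<open>Q\<close> each receive 1/4 from the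
      start, 1/2 from \<open>X\<close> and 1/4 from \<open>Y\<close> or \<open>Y'\<close>, in total
      1; \<open>Z\<close> receives 1/16 from each of \<open>Y\<close>, \<open>Y'\<close> and
      \<open>W\<close>, whence the constant 3/16.\<close>
    have linear: "(P + Q + 4 * X) / 4 + (Y + Y') / 4 + W / 16 \<le> P + Q + 3 / 16 * Z"
      if "4 * X \<le> 2 * P + 2 * Q" "4 * Y \<le> 4 * P + Z" "4 * Y' \<le> 4 * Q + Z" "W \<le> Z"
      for P Q X Y Y' Z W :: real
      using that by (simp add: field_simps)
    show ?thesis
      using a[of "f0 * g1" "f1 * g0"] b[of "f0 * g1" "f1 * g1"] b[of "f1 * g0" "f1 * g1"] c
      unfolding power_mult_distrib distrib_left by (rule linear)
  qed
  from mult_left_mono[OF this v] show ?thesis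
    unfolding lhs unfolding v_def[symmetric] by (simp add: algebra_simps)
qed

lemma noise_insert:
  assumes "finite S" "i \<notin> S"
  shows "noise r a (insert i S) = r * noise r (\<lambda>S. a (insert i S)) S"
  using assms by (simp add: noise_def)

lemma noise_noise: "noise r (noise s a) = noise (r * s) a"
  by (auto simp: noise_def power_mult_distrib)

lemma expansion_noise_insert:
  assumes "finite A" "i \<notin> A"
  shows "expansion A q (\<lambda>S. noise r a (insert i S)) X
    = r * expansion A q (noise r (\<lambda>S. a (insert i S))) X"
proof -
  have "noise r a (insert i S) = r * noise r (\<lambda>S. a (insert i S)) S" if "S \<in> Pow A" for S
    using that assms by (intro noise_insert) (auto intro: finite_subset)
  then show ?thesis
    by (simp add: expansion_def sum_distrib_left mult_ac)
qed

text \<open>Splitting off \<open>i\<close> and applying the two-point inequality at each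
  \<open>X\<close> leaves four expectations over \<open>A\<close>, for the pairs made of
  \<open>a\<close> or \<open>?a1\<close> and \<open>b\<close> or \<open>?b1\<close>. The induction
  hypothesis bounds each of them, hence the generalisation over both coefficient families.\<close>

lemma hypercontractivity:
  fixes q :: real
  assumes "finite A" "0 \<le> q" "q \<le> 1"
  defines "v \<equiv> q * (1 - q)"
  shows "expect A q (\<lambda>X. (expansion A q (noise (1/2) a) X)\<^sup>2 * (expansion A q (noise (1/2) b) X)\<^sup>2)
    \<le> (\<Sum>R\<in>Pow A. (3 / 16 * v) ^ card R * (deriv_norm A v a R * deriv_norm A v b R))"
  using assms(1)
proof (induction A arbitrary: a b rule: finite_induct)
  case empty
  show ?case by (simp add: expansion_def chr_def deriv_norm_def noise_def)
next
  case (insert i A)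
  have v: "0 \<le> v" using assms by (simp add: v_def)
  let ?a1 = "\<lambda>S. a (insert i S)" and ?b1 = "\<lambda>S. b (insert i S)"
  let ?e = "\<lambda>a. expansion A q (noise (1/2) a)"
  let ?N = "deriv_norm A v"
  let ?M = "deriv_norm (insert i A) v"
  have card: "card (insert i S) = Suc (card S)" if "S \<in> Pow A" for S
    using that insert.hyps by (meson PowD card_insert_disjoint finite_subset subsetD)
  have exp_notin: "expansion (insert i A) q (noise (1/2) a) X = ?e a X - q / 2 * ?e (\<lambda>S. a (insert i S)) X"
    if "X \<subseteq> A" for X a
    using insert.hyps that by (auto simp: expansion_insert expansion_noise_insert)
  have exp_in: "expansion (insert i A) q (noise (1/2) a) (insert i X)
      = ?e a X + (1 - q) / 2 * ?e (\<lambda>S. a (insert i S)) X"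
    if "X \<subseteq> A" for X a
    using insert.hyps that
    by (auto simp: expansion_insert expansion_noise_insert expansion_insert_point)
  have "expect (insert i A) q (\<lambda>X. (expansion (insert i A) q (noise (1/2) a) X)\<^sup>2
        * (expansion (insert i A) q (noise (1/2) b) X)\<^sup>2)
    = (1 - q) * expect A q (\<lambda>X. (?e a X - q / 2 * ?e ?a1 X)\<^sup>2 * (?e b X - q / 2 * ?e ?b1 X)\<^sup>2)
      + q * expect A q (\<lambda>X. (?e a X + (1 - q) / 2 * ?e ?a1 X)\<^sup>2 * (?e b X + (1 - q) / 2 * ?e ?b1 X)\<^sup>2)"
    unfolding expect_insert[OF insert.hyps]
    by (intro arg_cong2[where f = "(+)"] arg_cong2[where f = "(*)"] expect_cong refl)
      (simp_all only: exp_in exp_notin)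
  also have "\<dots> \<le> expect A q (\<lambda>X. (?e a X)\<^sup>2 * (?e b X)\<^sup>2
      + v * ((?e a X)\<^sup>2 * (?e ?b1 X)\<^sup>2 + (?e ?a1 X)\<^sup>2 * (?e b X)\<^sup>2)
      + 3 / 16 * v * ((?e ?a1 X)\<^sup>2 * (?e ?b1 X)\<^sup>2))"
    unfolding expect_cmult[symmetric] expect_add[symmetric] v_def
    using assms by (intro expect_mono two_point_inequality) auto
  also have "\<dots> = expect A q (\<lambda>X. (?e a X)\<^sup>2 * (?e b X)\<^sup>2)
      + v * (expect A q (\<lambda>X. (?e a X)\<^sup>2 * (?e ?b1 X)\<^sup>2) + expect A q (\<lambda>X. (?e ?a1 X)\<^sup>2 * (?e b X)\<^sup>2))
      + 3 / 16 * v * expect A q (\<lambda>X. (?e ?a1 X)\<^sup>2 * (?e ?b1 X)\<^sup>2)"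
    unfolding expect_add expect_cmult ..
  also have "\<dots> \<le> (\<Sum>R\<in>Pow A. (3 / 16 * v) ^ card R * (?N a R * ?N b R))
      + v * ((\<Sum>R\<in>Pow A. (3 / 16 * v) ^ card R * (?N a R * ?N ?b1 R))
        + (\<Sum>R\<in>Pow A. (3 / 16 * v) ^ card R * (?N ?a1 R * ?N b R)))
      + 3 / 16 * v * (\<Sum>R\<in>Pow A. (3 / 16 * v) ^ card R * (?N ?a1 R * ?N ?b1 R))"
    using v by (intro add_mono mult_left_mono insert.IH) auto
  also have "\<dots> = (\<Sum>R\<in>Pow A. (3 / 16 * v) ^ card R *
      (?N a R * ?N b R + v * (?N a R * ?N ?b1 R + ?N ?a1 R * ?N b R))
      + (3 / 16 * v) ^ card (insert i R) * (?N ?a1 R * ?N ?b1 R))"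
    by (simp add: sum_distrib_left sum.distrib distrib_left card mult_ac)
  \<comment> \<open>For sets without \<open>i\<close>, expanding the product of the two norms gives
    the left side plus a nonnegative \<open>v\<^sup>2\<close> term, which is dropped; for sets with
    \<open>i\<close> both sides agree.\<close>
  also have "\<dots> \<le> (\<Sum>R\<in>Pow A. (3 / 16 * v) ^ card R * (?M a R * ?M b R)
      + (3 / 16 * v) ^ card (insert i R) * (?M a (insert i R) * ?M b (insert i R)))"
  proof (intro sum_mono add_mono mult_left_mono)
    fix R assume "R \<in> Pow A"
    then have R: "R \<subseteq> A" by simp
    show "?N a R * ?N b R + v * (?N a R * ?N ?b1 R + ?N ?a1 R * ?N b R) \<le> ?M a R * ?M b R"
      using v deriv_norm_nonneg[OF v, of A ?a1 R] deriv_norm_nonneg[OF v, of A ?b1 R]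
      by (simp add: deriv_norm_insert_notin insert.hyps R algebra_simps)
    show "?N ?a1 R * ?N ?b1 R \<le> ?M a (insert i R) * ?M b (insert i R)"
      by (simp add: deriv_norm_insert_in insert.hyps R)
  qed (use v in auto)
  also have "\<dots> = (\<Sum>R\<in>Pow (insert i A). (3 / 16 * v) ^ card R * (?M a R * ?M b R))"
    unfolding sum_Pow_insert[OF insert.hyps] sum.distrib ..
  finally show ?case .
qed

text \<open>Double counting: the coefficient at \<open>S\<close> occurs once for each of the
  \<open>2 ^ card S\<close> subsets \<open>R\<close> of \<open>S\<close>, every time with weight
  \<open>v ^ card S\<close>.\<close>

lemma sum_deriv_norm:
  assumes "finite A"
  shows "(\<Sum>R\<in>Pow A. v ^ card R * deriv_norm A v a R) = (\<Sum>S\<in>Pow A. (2 * v) ^ card S * (a S)\<^sup>2)"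
  using assms
proof (induction A arbitrary: a rule: finite_induct)
  case empty
  show ?case by (simp add: deriv_norm_def)
next
  case (insert i A)
  let ?a1 = "\<lambda>S. a (insert i S)"
  have card: "card (insert i S) = Suc (card S)" if "S \<in> Pow A" for S
    using that insert.hyps by (meson PowD card_insert_disjoint finite_subset subsetD)
  have "(\<Sum>R\<in>Pow (insert i A). v ^ card R * deriv_norm (insert i A) v a R)
    = (\<Sum>R\<in>Pow A. v ^ card R * deriv_norm A v a R)
      + 2 * v * (\<Sum>R\<in>Pow A. v ^ card R * deriv_norm A v ?a1 R)"
    unfolding sum_Pow_insert[OF insert.hyps] sum_distrib_left sum.distrib[symmetric]
    using insert.hyps
    by (intro sum.cong refl) (simp add: deriv_norm_insert_in deriv_norm_insert_notin card algebra_simps)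
  also have "\<dots> = (\<Sum>S\<in>Pow (insert i A). (2 * v) ^ card S * (a S)\<^sup>2)"
    unfolding insert.IH sum_Pow_insert[OF insert.hyps] sum_distrib_left
    by (intro arg_cong2[where f = "(+)"] sum.cong refl) (simp_all add: card)
  finally show ?case .
qed

text \<open>Every coefficient entering the norm sits at a superset of \<open>R\<close>, so the noise
  damps it at least \<open>card R\<close> times. With \<open>r = 1/2\<close> this gain cancels the
  factor \<open>4 ^ card R\<close> of \<open>deriv_norm_le\<close>.\<close>

lemma deriv_norm_noise_le:
  assumes "finite A" "R \<subseteq> A" "0 \<le> v" "0 \<le> r" "r \<le> 1"
  shows "deriv_norm A v (noise r a) R \<le> (r\<^sup>2) ^ card R * deriv_norm A v a R"
  unfolding deriv_norm_def sum_distrib_left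
proof (intro sum_mono)
  fix S assume "S \<in> Pow (A - R)"
  then have "card (S \<union> R) = card S + card R"
    using assms by (intro card_Un_disjoint) (auto intro: finite_subset)
  then have "(noise r a (S \<union> R))\<^sup>2 = (r\<^sup>2) ^ card S * ((r\<^sup>2) ^ card R * (a (S \<union> R))\<^sup>2)"
    by (simp add: noise_def power_add power_mult_distrib flip: power_mult) (simp add: mult.commute)
  also have "\<dots> \<le> (r\<^sup>2) ^ card R * (a (S \<union> R))\<^sup>2"
    using assms by (intro mult_left_le_one_le) (auto intro!: power_le_one)
  finally show "v ^ card S * (noise r a (S \<union> R))\<^sup>2
      \<le> (r\<^sup>2) ^ card R * (v ^ card S * (a (S \<union> R))\<^sup>2)"
    using assms by (subst mult.left_commute) (intro mult_left_mono, auto)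
qed

section \<open>Discrete derivatives of monotone functions\<close>

lemma deriv_norm_eq_expect:
  assumes "finite A"
  shows "deriv_norm A (q * (1 - q)) a R
    = expect (A - R) q (\<lambda>X. (expansion (A - R) q (\<lambda>S. a (S \<union> R)) X)\<^sup>2)"
  using expect_expansion_mult[of "A - R" q "\<lambda>S. a (S \<union> R)" "\<lambda>S. a (S \<union> R)"] assms
  by (simp add: deriv_norm_def power2_eq_square)

text \<open>Identifies the shift of coefficients by \<open>R\<close> with an iterated discrete
  derivative, one coordinate at a time.\<close>

lemma expansion_deriv_step:
  assumes "finite A" "i \<in> A" "i \<notin> R" "X \<subseteq> A - insert i R"
  shows "expansion (A - insert i R) q (\<lambda>S. a (S \<union> insert i R)) X
    = expansion (A - R) q (\<lambda>S. a (S \<union> R)) (insert i X) - expansion (A - R) q (\<lambda>S. a (S \<union> R)) X"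
proof -
  define B where "B = A - insert i R"
  have eq: "A - R = insert i B" using assms by (auto simp: B_def)
  have "i \<notin> B" "finite B" "i \<notin> X" using assms by (auto simp: B_def)
  then show ?thesis
    unfolding eq B_def[symmetric]
    by (simp add: expansion_insert expansion_insert_point) (simp add: algebra_simps)
qed

text \<open>The derivative is a signed sum of the \<open>2 ^ card R\<close> values of
  \<open>f\<close> at \<open>X \<union> T\<close> with \<open>T \<subseteq> R\<close>, and each lies
  between 0 and \<open>f (X \<union> R)\<close>.\<close>

lemma expansion_deriv_bound:
  assumes "finite A" "R \<subseteq> A"
    and f: "\<And>X. X \<subseteq> A \<Longrightarrow> f X = expansion A q a X"
    and mono: "\<And>X Y. X \<subseteq> Y \<Longrightarrow> Y \<subseteq> A \<Longrightarrow> f X \<le> f Y"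
    and nonneg: "\<And>X. X \<subseteq> A \<Longrightarrow> 0 \<le> f X"
    and "X \<subseteq> A - R"
  shows "\<bar>expansion (A - R) q (\<lambda>S. a (S \<union> R)) X\<bar> \<le> 2 ^ card R * f (X \<union> R)"
proof -
  have "finite R" using assms(2,1) by (rule finite_subset)
  then show ?thesis
    using \<open>R \<subseteq> A\<close> \<open>X \<subseteq> A - R\<close>
  proof (induction R arbitrary: X rule: finite_induct)
    case empty
    then show ?case using f[of X] nonneg[of X] by simp
  next
    case (insert i R)
    let ?E = "expansion (A - R) q (\<lambda>S. a (S \<union> R))"
    have "\<bar>?E (insert i X)\<bar> \<le> 2 ^ card R * f (insert i X \<union> R)"
      using insert.prems insert.hyps by (intro insert.IH) auto
    moreover have "\<bar>?E X\<bar> \<le> 2 ^ card R * f (X \<union> R)"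
      using insert.prems insert.hyps by (intro insert.IH) auto
    moreover have "2 ^ card R * f (X \<union> R) \<le> 2 ^ card R * f (insert i X \<union> R)"
      using insert.prems by (intro mult_left_mono mono) auto
    ultimately have "\<bar>?E (insert i X) - ?E X\<bar> \<le> 2 ^ card (insert i R) * f (insert i X \<union> R)"
      unfolding card_insert_disjoint[OF insert.hyps] power_Suc by linarith
    moreover have "expansion (A - insert i R) q (\<lambda>S. a (S \<union> insert i R)) X = ?E (insert i X) - ?E X"
      using insert.prems insert.hyps assms(1) by (intro expansion_deriv_step) auto
    moreover have "insert i X \<union> R = X \<union> insert i R" by auto
    ultimately show ?case by simp
  qed
qed

section \<open>Total influence and Russo's formula\<close>

text \<open>The differences carry no absolute value, so Russo's formula holds for every real
  function; for a monotone indicator each summand is the probability that the coordinate is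
  pivotal.\<close>

definition influence :: "'a set \<Rightarrow> real \<Rightarrow> ('a set \<Rightarrow> real) \<Rightarrow> real" where
  "influence A q f = (\<Sum>i\<in>A. expect (A - {i}) q (\<lambda>X. f (insert i X) - f X))"

text \<open>Conditioning on coordinate \<open>i\<close> makes the expectation a mixture with weights
  \<open>1 - q\<close> and \<open>q\<close>. Differentiating the weights yields the influence of
  \<open>i\<close>; differentiating the two parts yields the other influences.\<close>

lemma Russo_formula:
  assumes "finite A"
  shows "((\<lambda>q. expect A q f) has_real_derivative influence A q f) (at q)"
  using assms
proof (induction A arbitrary: f rule: finite_induct)
  case empty
  show ?case by (simp add: influence_def)
next
  case (insert i A)
  let ?f1 = "\<lambda>X. f (insert i X)"
  have "((\<lambda>q. (1 - q) * expect A q f + q * expect A q ?f1) has_real_derivative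
      (1 - q) * influence A q f - expect A q f + (q * influence A q ?f1 + expect A q ?f1)) (at q)"
    by (auto intro!: derivative_eq_intros insert.IH)
  moreover have "influence (insert i A) q f
      = (1 - q) * influence A q f - expect A q f + (q * influence A q ?f1 + expect A q ?f1)"
  proof -
    have "expect (insert i A - {j}) q (\<lambda>X. f (insert j X) - f X)
        = (1 - q) * expect (A - {j}) q (\<lambda>X. f (insert j X) - f X)
          + q * expect (A - {j}) q (\<lambda>X. ?f1 (insert j X) - ?f1 X)" if "j \<in> A" for j
    proof -
      have "insert i A - {j} = insert i (A - {j})" using that insert.hyps by auto
      then show ?thesis
        using insert.hyps by (simp add: expect_insert insert_commute)
    qed
    then show ?thesis
      using insert.hyps
      by (simp add: influence_def sum.distrib sum_distrib_left expect_diff)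
  qed
  ultimately show ?case
    using insert.hyps by (simp add: expect_insert)
qed

lemma influence_nonneg:
  assumes "0 \<le> q" "q \<le> 1"
    and mono: "\<And>X Y. X \<subseteq> Y \<Longrightarrow> Y \<subseteq> A \<Longrightarrow> f X \<le> f Y"
  shows "0 \<le> influence A q f"
  unfolding influence_def
proof (intro sum_nonneg expect_nonneg assms)
  fix i X assume "i \<in> A" "X \<subseteq> A - {i}"
  then show "0 \<le> f (insert i X) - f X"
    using mono[of X "insert i X"] by auto
qed

text \<open>Writing \<open>card S\<close> as a sum over its elements and exchanging sums leaves, for
  each \<open>i\<close>, the mass of the coefficients at sets containing \<open>i\<close>, which is
  that of the derivative in \<open>i\<close>.\<close>

lemma influence_eq_sum:
  fixes F :: "'a set \<Rightarrow> bool"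
  assumes "finite A"
    and mono: "\<And>X Y. X \<subseteq> Y \<Longrightarrow> Y \<subseteq> A \<Longrightarrow> F X \<Longrightarrow> F Y"
    and a: "\<And>X. X \<subseteq> A \<Longrightarrow> of_bool (F X) = expansion A q a X"
  shows "(\<Sum>S\<in>Pow A. real (card S) * ((q * (1 - q)) ^ card S * (a S)\<^sup>2))
    = q * (1 - q) * influence A q (\<lambda>X. of_bool (F X))"
proof -
  define v where "v = q * (1 - q)"
  have "(\<Sum>S\<in>Pow A. real (card S) * (v ^ card S * (a S)\<^sup>2))
      = (\<Sum>S\<in>Pow A. \<Sum>i\<in>A. of_bool (i \<in> S) * (v ^ card S * (a S)\<^sup>2))"
  proof (intro sum.cong refl)
    fix S assume "S \<in> Pow A"
    then have "(\<Sum>i\<in>A. of_bool (i \<in> S) :: real) = real (card S)"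
      using assms(1) by (simp add: Int_absorb1)
    then show "real (card S) * (v ^ card S * (a S)\<^sup>2)
        = (\<Sum>i\<in>A. of_bool (i \<in> S) * (v ^ card S * (a S)\<^sup>2))"
      by (simp add: sum_distrib_right[symmetric])
  qed
  also have "\<dots> = (\<Sum>i\<in>A. \<Sum>S\<in>Pow A. of_bool (i \<in> S) * (v ^ card S * (a S)\<^sup>2))"
    by (rule sum.swap)
  also have "\<dots> = (\<Sum>i\<in>A. v * expect (A - {i}) q (\<lambda>X. of_bool (F (insert i X)) - of_bool (F X)))"
  proof (intro sum.cong refl)
    fix i assume i: "i \<in> A"
    define B where "B = A - {i}"
    have B: "A = insert i B" "i \<notin> B" "finite B" using i assms(1) by (auto simp: B_def)
    have notin: "i \<notin> S" "finite S" if "S \<in> Pow B" for S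
      using that B finite_subset by blast+
    \<comment> \<open>The factor \<open>v\<close> is the weight of \<open>i\<close> itself, since
      \<open>deriv_norm\<close> weighs only the coordinates outside \<open>{i}\<close>.\<close>
    have "(\<Sum>S\<in>Pow A. of_bool (i \<in> S) * (v ^ card S * (a S)\<^sup>2)) = v * deriv_norm A v a {i}"
      unfolding deriv_norm_def B_def[symmetric] unfolding B(1) sum_Pow_insert[OF B(3,2)]
      by (simp add: notin sum_distrib_left mult_ac)
    also have "deriv_norm A v a {i}
        = expect B q (\<lambda>X. (expansion B q (\<lambda>S. a (S \<union> {i})) X)\<^sup>2)"
      unfolding v_def deriv_norm_eq_expect[OF assms(1)] B_def ..
    also have "\<dots> = expect B q (\<lambda>X. of_bool (F (insert i X)) - of_bool (F X))"
    proof (intro expect_cong)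
      fix X assume X: "X \<subseteq> B"
      then have sub: "X \<subseteq> A" "insert i X \<subseteq> A" using i by (auto simp: B_def)
      have "expansion B q (\<lambda>S. a (S \<union> {i})) X = expansion A q a (insert i X) - expansion A q a X"
        using expansion_deriv_step[of A i "{}" X q a] X i assms(1) by (simp add: B_def)
      also have "\<dots> = of_bool (F (insert i X)) - of_bool (F X)"
        using a sub by simp
      \<comment> \<open>By monotonicity the difference is 0 or 1, hence equal to its square.\<close>
      finally show "(expansion B q (\<lambda>S. a (S \<union> {i})) X)\<^sup>2
          = (of_bool (F (insert i X)) - of_bool (F X) :: real)"
        using mono[of X "insert i X"] sub by auto
    qed
    finally show "(\<Sum>S\<in>Pow A. of_bool (i \<in> S) * (v ^ card S * (a S)\<^sup>2))
        = v * expect (A - {i}) q (\<lambda>X. of_bool (F (insert i X)) - of_bool (F X))"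
      by (simp add: B_def)
  qed
  finally show ?thesis
    by (simp add: influence_def v_def sum_distrib_left)
qed

section \<open>The fourth moment and the lower bound on the influence\<close>

text \<open>Globalness can be applied to the right side, the measure of the restriction with
  \<open>R\<close> set to 1. It follows by squaring \<open>expansion_deriv_bound\<close>, as an
  indicator is its own square.\<close>

lemma deriv_norm_le:
  fixes F :: "'a set \<Rightarrow> bool"
  assumes "finite A" "0 \<le> q" "q \<le> 1" "R \<subseteq> A"
    and mono: "\<And>X Y. X \<subseteq> Y \<Longrightarrow> Y \<subseteq> A \<Longrightarrow> F X \<Longrightarrow> F Y"
    and a: "\<And>X. X \<subseteq> A \<Longrightarrow> of_bool (F X) = expansion A q a X"
  shows "deriv_norm A (q * (1 - q)) a R \<le> 4 ^ card R * expect (A - R) q (\<lambda>X. of_bool (F (X \<union> R)))"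
  unfolding deriv_norm_eq_expect[OF assms(1)] expect_cmult[symmetric]
proof (intro expect_mono assms)
  fix X assume "X \<subseteq> A - R"
  then have "\<bar>expansion (A - R) q (\<lambda>S. a (S \<union> R)) X\<bar> \<le> 2 ^ card R * of_bool (F (X \<union> R))"
    using assms(1,4)
    by (intro expansion_deriv_bound[where f = "\<lambda>X. of_bool (F X)"] a) (auto intro: mono)
  then have "(expansion (A - R) q (\<lambda>S. a (S \<union> R)) X)\<^sup>2 \<le> (2 ^ card R * of_bool (F (X \<union> R)))\<^sup>2"
    by (rule abs_le_square_iff[THEN iffD1, OF order_trans]) simp
  also have "\<dots> = 4 ^ card R * of_bool (F (X \<union> R))"
    by (simp add: power_mult_distrib power2_eq_square flip: power_mult_distrib)
  finally show "(expansion (A - R) q (\<lambda>S. a (S \<union> R)) X)\<^sup>2 \<le> 4 ^ card R * of_bool (F (X \<union> R))" .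
qed

text \<open>The noise 1/4 is split into two halves. One pays for hypercontractivity; the other
  cancels \<open>4 ^ card R\<close> in the derivative bound and later beats the
  \<open>2 ^ card S\<close> of \<open>sum_deriv_norm\<close>. In each product of two derivative
  norms, one factor is bounded by means of \<open>\<epsilon>\<close> and the other is summed over
  \<open>R\<close>.\<close>

lemma noise_fourth_moment:
  fixes F :: "'a set \<Rightarrow> bool"
  assumes "finite A" "0 \<le> q" "q \<le> 1"
    and mono: "\<And>X Y. X \<subseteq> Y \<Longrightarrow> Y \<subseteq> A \<Longrightarrow> F X \<Longrightarrow> F Y"
    and a: "\<And>X. X \<subseteq> A \<Longrightarrow> of_bool (F X) = expansion A q a X"
    and small: "\<And>R. R \<subseteq> A \<Longrightarrow> (3 / 16) ^ card R * expect (A - R) q (\<lambda>X. of_bool (F (X \<union> R))) \<le> \<epsilon>"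
  shows "expect A q (\<lambda>X. (expansion A q (noise (1/4) a) X) ^ 4)
    \<le> \<epsilon> * expect A q (\<lambda>X. of_bool (F X))"
proof -
  define v where "v = q * (1 - q)"
  have v: "0 \<le> v" using assms by (simp add: v_def)
  let ?b = "noise (1/2) a"
  let ?N = "deriv_norm A v ?b"
  have coeff: "(3 / 16) ^ card R * ?N R \<le> \<epsilon>" if R: "R \<subseteq> A" for R
  proof -
    have "?N R \<le> (1 / 4) ^ card R * deriv_norm A v a R"
      using deriv_norm_noise_le[of A R v "1/2" a] R v assms(1) by (simp add: power2_eq_square)
    also have "\<dots> \<le> (1 / 4) ^ card R * (4 ^ card R * expect (A - R) q (\<lambda>X. of_bool (F (X \<union> R))))"
      unfolding v_def using assms R by (intro mult_left_mono deriv_norm_le) auto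
    also have "\<dots> = expect (A - R) q (\<lambda>X. of_bool (F (X \<union> R)))"
      by (simp add: power_divide)
    finally have "(3 / 16) ^ card R * ?N R
        \<le> (3 / 16) ^ card R * expect (A - R) q (\<lambda>X. of_bool (F (X \<union> R)))"
      by (intro mult_left_mono) auto
    with small[OF R] show ?thesis by linarith
  qed
  have N: "(3 / 16 * v) ^ card R * (?N R * ?N R) \<le> \<epsilon> * (v ^ card R * ?N R)" if "R \<subseteq> A" for R
  proof -
    have "0 \<le> v ^ card R * ?N R" using v by (simp add: deriv_norm_nonneg)
    then have "((3 / 16) ^ card R * ?N R) * (v ^ card R * ?N R) \<le> \<epsilon> * (v ^ card R * ?N R)"
      by (rule mult_right_mono[OF coeff[OF that]])
    then show ?thesis unfolding power_mult_distrib by (simp only: mult_ac)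
  qed
  have "expect A q (\<lambda>X. (expansion A q (noise (1/4) a) X) ^ 4)
    = expect A q (\<lambda>X. (expansion A q (noise (1/2) ?b) X)\<^sup>2 * (expansion A q (noise (1/2) ?b) X)\<^sup>2)"
    by (simp add: noise_noise flip: power_add)
  also have "\<dots> \<le> (\<Sum>R\<in>Pow A. (3 / 16 * v) ^ card R * (?N R * ?N R))"
    unfolding v_def using assms by (intro hypercontractivity) auto
  also have "\<dots> \<le> (\<Sum>R\<in>Pow A. \<epsilon> * (v ^ card R * ?N R))"
    using N by (intro sum_mono) auto
  also have "\<dots> = \<epsilon> * (\<Sum>S\<in>Pow A. (2 * v) ^ card S * (?b S)\<^sup>2)"
    using sum_deriv_norm[OF assms(1), of v ?b] by (simp add: sum_distrib_left[symmetric])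
  also have "\<dots> \<le> \<epsilon> * (\<Sum>S\<in>Pow A. v ^ card S * (a S * a S))"
  proof (intro mult_left_mono sum_mono)
    fix S assume "S \<in> Pow A"
    have "(2 * v) ^ card S * (?b S)\<^sup>2 = (1 / 2) ^ card S * (v ^ card S * (a S * a S))"
      by (simp add: noise_def power_mult_distrib power_divide power2_eq_square field_simps)
    also have "\<dots> \<le> v ^ card S * (a S * a S)"
      using v by (intro mult_left_le_one_le) (auto simp: power_le_one)
    finally show "(2 * v) ^ card S * (?b S)\<^sup>2 \<le> v ^ card S * (a S * a S)" .
  next
    show "0 \<le> \<epsilon>"
      using small[of "{}"] expect_nonneg[OF assms(2,3), of A "\<lambda>X. of_bool (F X)"] by simp
  qed
  also have "(\<Sum>S\<in>Pow A. v ^ card S * (a S * a S)) = expect A q (\<lambda>X. of_bool (F X))"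
    unfolding v_def expect_expansion_mult[OF assms(1), symmetric]
    by (intro expect_cong) (simp flip: a)
  finally show ?thesis .
qed

text \<open>Hoelder with exponents 4/3 and 4, obtained from Cauchy-Schwarz used twice and the fact
  that an indicator equals its square.\<close>

lemma expect_indicator_mult_power4:
  fixes F :: "'a set \<Rightarrow> bool"
  assumes "0 \<le> q" "q \<le> 1"
  shows "(expect A q (\<lambda>X. of_bool (F X) * g X)) ^ 4
    \<le> (expect A q (\<lambda>X. of_bool (F X))) ^ 3 * expect A q (\<lambda>X. g X ^ 4)"
proof -
  let ?f = "\<lambda>X. of_bool (F X) :: real"
  define m where "m = expect A q ?f"
  have f: "?f X * (?f X * y) = ?f X * y" "(?f X)\<^sup>2 = ?f X" for X y by auto
  have "(expect A q (\<lambda>X. ?f X * g X))\<^sup>2 \<le> m * expect A q (\<lambda>X. ?f X * (g X)\<^sup>2)"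
    using expect_Cauchy_Schwarz[OF assms, of A ?f "\<lambda>X. ?f X * g X"]
    by (simp add: m_def power_mult_distrib f)
  then have "((expect A q (\<lambda>X. ?f X * g X))\<^sup>2)\<^sup>2 \<le> (m * expect A q (\<lambda>X. ?f X * (g X)\<^sup>2))\<^sup>2"
    by (intro power_mono) auto
  also have "\<dots> = m\<^sup>2 * (expect A q (\<lambda>X. ?f X * (g X)\<^sup>2))\<^sup>2"
    by (simp add: power_mult_distrib)
  also have "\<dots> \<le> m\<^sup>2 * (m * expect A q (\<lambda>X. g X ^ 4))"
    using expect_Cauchy_Schwarz[OF assms, of A ?f "\<lambda>X. (g X)\<^sup>2"]
    by (intro mult_left_mono) (simp_all add: m_def f flip: power_mult)
  finally show ?thesis
    unfolding m_def[symmetric] by (simp add: power2_eq_square power3_eq_cube power4_eq_xxxx mult_ac)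
qed

lemma influence_lower_bound:
  fixes F :: "'a set \<Rightarrow> bool"
  assumes "finite A" "0 \<le> q" "q \<le> 1"
    and mono: "\<And>X Y. X \<subseteq> Y \<Longrightarrow> Y \<subseteq> A \<Longrightarrow> F X \<Longrightarrow> F Y"
  defines "m \<equiv> expect A q (\<lambda>X. of_bool (F X))"
  assumes pos: "0 < m"
    and small: "\<And>R. R \<subseteq> A \<Longrightarrow>
      (3 / 16) ^ card R * expect (A - R) q (\<lambda>X. of_bool (F (X \<union> R))) \<le> m powr 0.01"
  shows "- (m * ln m) / 1000 \<le> q * influence A q (\<lambda>X. of_bool (F X))"
proof -
  obtain a where a: "\<And>X. X \<subseteq> A \<Longrightarrow> of_bool (F X) = expansion A q a X"
    using expansion_exists[OF assms(1), of "\<lambda>X. of_bool (F X)" q] by blast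
  define I where "I = influence A q (\<lambda>X. of_bool (F X))"
  have I: "0 \<le> I"
    unfolding I_def using assms(2,3) mono by (intro influence_nonneg) auto
  \<comment> \<open>The spectral distribution: total mass \<open>m\<close> by Parseval and, by
    \<open>influence_eq_sum\<close>, mean degree \<open>K\<close>.\<close>
  define w where "w S = (q * (1 - q)) ^ card S * (a S)\<^sup>2" for S
  have w: "0 \<le> w S" for S using assms by (simp add: w_def)
  define K where "K = q * (1 - q) * I / m"
  let ?Tf = "expansion A q (noise (1/4) a)"
  have sum_w: "(\<Sum>S\<in>Pow A. w S) = m"
  proof -
    have "(\<Sum>S\<in>Pow A. w S) = expect A q (\<lambda>X. expansion A q a X * expansion A q a X)"
      unfolding expect_expansion_mult[OF assms(1)] w_def power2_eq_square ..
    also have "\<dots> = m" unfolding m_def by (intro expect_cong) (simp flip: a)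
    finally show ?thesis .
  qed
  have sum_card_w: "(\<Sum>S\<in>Pow A. real (card S) * w S) = K * m"
    using influence_eq_sum[of A F q a] assms(1) mono a pos by (simp add: w_def K_def I_def)
  have Tf: "expect A q (\<lambda>X. of_bool (F X) * ?Tf X) = (\<Sum>S\<in>Pow A. (1/4) ^ card S * w S)"
  proof -
    have "expect A q (\<lambda>X. of_bool (F X) * ?Tf X) = expect A q (\<lambda>X. expansion A q a X * ?Tf X)"
      by (intro expect_cong) (simp flip: a)
    also have "\<dots> = (\<Sum>S\<in>Pow A. (1/4) ^ card S * w S)"
      unfolding expect_expansion_mult[OF assms(1)] w_def noise_def
      by (simp add: power2_eq_square mult_ac)
    finally show ?thesis .
  qed
  \<comment> \<open>Jensen's inequality by hand: the exponential is bounded below by its tangent at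
    \<open>K\<close>, and the linear term sums to 0 because \<open>K\<close> is the mean
    degree.\<close>
  have "exp (- K * ln 4) * m \<le> expect A q (\<lambda>X. of_bool (F X) * ?Tf X)"
  proof -
    have "exp (- K * ln 4) * m
      = (\<Sum>S\<in>Pow A. exp (- K * ln 4) * (1 + (K - card S) * ln 4) * w S)"
    proof -
      have "(\<Sum>S\<in>Pow A. exp (- K * ln 4) * (1 + (K - card S) * ln 4) * w S)
        = exp (- K * ln 4) * (1 + K * ln 4) * (\<Sum>S\<in>Pow A. w S)
          - exp (- K * ln 4) * ln 4 * (\<Sum>S\<in>Pow A. real (card S) * w S)"
        unfolding sum_distrib_left sum_subtractf[symmetric]
        by (intro sum.cong refl) (simp add: algebra_simps)
      then show ?thesis unfolding sum_w sum_card_w by (simp add: algebra_simps)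
    qed
    also have "\<dots> \<le> (\<Sum>S\<in>Pow A. (1/4) ^ card S * w S)"
    proof (intro sum_mono mult_right_mono w)
      fix S
      have "exp (- K * ln 4) * (1 + (K - card S) * ln 4)
          \<le> exp (- K * ln 4) * exp ((K - card S) * ln 4)"
        by (intro mult_left_mono exp_ge_add_one_self) auto
      also have "\<dots> = exp (- (real (card S) * ln 4))"
        by (simp add: algebra_simps flip: exp_add)
      also have "\<dots> = (1/4) ^ card S"
        by (simp add: exp_minus exp_of_nat_mult power_divide inverse_eq_divide)
      finally show "exp (- K * ln 4) * (1 + (K - card S) * ln 4) \<le> (1/4) ^ card S" .
    qed
    finally show ?thesis unfolding Tf .
  qed
  then have "(exp (- K * ln 4) * m) ^ 4 \<le> (expect A q (\<lambda>X. of_bool (F X) * ?Tf X)) ^ 4"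
    using pos by (intro power_mono) auto
  also have "\<dots> \<le> m ^ 3 * expect A q (\<lambda>X. ?Tf X ^ 4)"
    unfolding m_def using assms(2,3) by (rule expect_indicator_mult_power4)
  also have "\<dots> \<le> m ^ 3 * (m powr 0.01 * m)"
    unfolding m_def using assms(1-3) mono a small pos
    by (intro mult_left_mono noise_fourth_moment) (auto simp: m_def)
  also have "\<dots> = m powr 0.01 * m ^ 4"
    by (simp add: power3_eq_cube power4_eq_xxxx)
  finally have "exp (- K * ln 4) ^ 4 \<le> m powr 0.01"
    using pos by (simp add: power_mult_distrib)
  then have "exp (- 4 * K * ln 4) \<le> exp (0.01 * ln m)"
    using pos by (simp add: powr_def flip: exp_of_nat_mult)
  \<comment> \<open>The constant 800 below is 100 * 4 * 2, with \<open>ln 4\<close> estimated by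
    2.\<close>
  then have "- ln m / 100 \<le> 4 * K * ln 4" by simp
  also have "\<dots> \<le> 4 * K * 2"
  proof -
    have "ln (4::real) = 2 * ln 2" using ln_realpow[of 2 2] by simp
    moreover have "ln (2::real) \<le> 1" using ln_le_minus_one[of 2] by simp
    moreover have "0 \<le> K" using assms(2,3) I pos by (simp add: K_def)
    ultimately show ?thesis by (intro mult_left_mono) auto
  qed
  finally have "- ln m / 800 \<le> K" by simp
  then have "m * (- ln m / 800) \<le> q * (1 - q) * I"
    using pos by (simp add: K_def pos_le_divide_eq mult.commute)
  also have "\<dots> \<le> q * I"
    using assms(2,3) I by (intro mult_right_mono) (auto simp: mult_left_le)
  finally have "- (m * ln m) / 800 \<le> q * I" by simp
  \<comment> \<open>Weakening 800 to 1000 requires this sign, which comes from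
    \<open>m \<le> 1\<close>.\<close>
  moreover have "0 \<le> - (m * ln m)"
  proof -
    have "m \<le> 1"
      unfolding m_def using expect_mono[OF assms(2,3), of A "\<lambda>X. of_bool (F X)" "\<lambda>_. 1"]
      by (simp add: expect_const[OF assms(1)])
    then show ?thesis using pos by (simp add: mult_nonneg_nonpos)
  qed
  ultimately show ?thesis unfolding I_def by simp
qed

section \<open>Passage from \<open>mu\<close> to expectations over sets\<close>

lemma expect_1: "finite A \<Longrightarrow> expect A 1 g = g A"
  by (induction A arbitrary: g rule: finite_induct) (simp_all add: expect_insert)

lemma expect_0: "finite A \<Longrightarrow> expect A 0 g = g {}"
  by (induction A arbitrary: g rule: finite_induct) (simp_all add: expect_insert)

text \<open>The range of \<open>q\<close> matters: \<open>bernoulli_pmf\<close> truncates its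
  parameter to the unit interval, whereas \<open>expect\<close> is a polynomial in
  \<open>q\<close>.\<close>

lemma mu_eq_expect:
  assumes "finite A" "0 \<le> q" "q \<le> 1"
  shows "mu A q f = expect A q (\<lambda>X. of_bool (f (\<lambda>i. i \<in> X)))"
proof -
  have fin: "finite (cube A)"
    unfolding cube_def using assms(1) by (intro finite_PiE_dflt) auto
  have "mu A q f = (\<Sum>x\<in>cube A. of_bool (f x) * pmf (biased A q) x)"
    unfolding mu_def
    using set_Pi_pmf_subset[OF assms(1), of False "\<lambda>_. bernoulli_pmf q"]
    by (subst integral_measure_pmf[OF fin]) (auto simp: cube_def biased_def PiE_dflt_def mult_ac)
  also have "\<dots> = (\<Sum>X\<in>Pow A. of_bool (f (\<lambda>i. i \<in> X)) * pmf (biased A q) (\<lambda>i. i \<in> X))"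
    by (rule sum.reindex_bij_witness[of _ "\<lambda>X i. i \<in> X" "\<lambda>x. {i. x i}"])
      (auto simp: cube_def PiE_dflt_def)
  also have "\<dots> = expect A q (\<lambda>X. of_bool (f (\<lambda>i. i \<in> X)))"
    unfolding expect_def
  proof (intro sum.cong refl)
    fix X assume "X \<in> Pow A"
    then have X: "X \<subseteq> A" by simp
    have "pmf (biased A q) (\<lambda>i. i \<in> X) = (\<Prod>i\<in>A. if i \<in> X then q else 1 - q)"
      unfolding biased_def using X assms
      by (subst pmf_Pi'[OF assms(1)]) (auto intro!: prod.cong)
    also have "\<dots> = q ^ card X * (1 - q) ^ card (A - X)"
      using X assms(1) by (simp add: prod.If_cases Int_absorb1 Diff_eq)
    finally show "of_bool (f (\<lambda>i. i \<in> X)) * pmf (biased A q) (\<lambda>i. i \<in> X)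
        = q ^ card X * (1 - q) ^ card (A - X) * of_bool (f (\<lambda>i. i \<in> X))"
      by simp
  qed
  finally show ?thesis .
qed

lemma mu_set_ones_eq_expect:
  assumes "finite A" "0 \<le> q" "q \<le> 1"
  shows "mu (A - J) q (set_ones J f) = expect (A - J) q (\<lambda>X. of_bool (f (\<lambda>i. i \<in> X \<union> J)))"
proof -
  have "(\<lambda>i. if i \<in> J then True else i \<in> X) = (\<lambda>i. i \<in> X \<union> J)" for X :: "nat set"
    by auto
  then show ?thesis
    using assms by (simp add: mu_eq_expect set_ones_def)
qed

text \<open>Serves the sets \<open>R\<close> with more than \<open>M\<close> elements, about which
  globalness says nothing. As 3/16 is below 1/e, the power is at most \<open>exp (- M)\<close>, far
  below \<open>exp (- M / 1000) powr 0.01\<close>.\<close>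

lemma three_sixteenths_power_le:
  assumes "M < real k" "exp (- M / 1000) \<le> m" "0 < M"
  shows "(3 / 16) ^ k \<le> m powr 0.01"
proof -
  have "(3 / 16 :: real) \<le> exp (- 1)"
    using exp_le by (simp add: exp_minus field_simps)
  then have "(3 / 16 :: real) ^ k \<le> exp (- 1) ^ k"
    by (intro power_mono) auto
  also have "\<dots> = exp (- real k)"
    by (simp flip: exp_of_nat_mult)
  also have "\<dots> \<le> exp (- M / 1000) powr 0.01"
    using assms by (simp add: powr_def)
  also have "\<dots> \<le> m powr 0.01"
    using assms(2) by (intro powr_mono2) auto
  finally show ?thesis .
qed

section \<open>The differential inequality between \<open>p\<close> and the critical
  probability\<close>

theorem theorem2p1:
  "\<exists>C::real. C > 0 \<and>
     (\<forall>(n::nat) (f :: (nat \<Rightarrow> bool) \<Rightarrow> bool) (p::real) (M::real).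
        monotone_boolean {1..n} f \<longrightarrow>
        p \<in> {0..1} \<longrightarrow>
        p \<le> critical_prob {1..n} f \<longrightarrow>
        M > 0 \<longrightarrow>
        global_in {1..n} M {p..critical_prob {1..n} f} f \<longrightarrow>
        mu {1..n} p f \<ge> exp (- M / C) \<longrightarrow>
        critical_prob {1..n} f \<le> M powr C * p)"
\<comment> \<open>The value 1000 is the constant of \<open>influence_lower_bound\<close>;
  integration turns it into the exponent of \<open>M\<close>.\<close>
proof (intro exI[of _ 1000] conjI allI impI)
  fix n :: nat and f :: "(nat \<Rightarrow> bool) \<Rightarrow> bool" and p M :: real
  define A where "A = {1..n}"
  define pc where "pc = critical_prob A f"
  assume "monotone_boolean {1..n} f" and p: "p \<in> {0..1}" and "p \<le> critical_prob {1..n} f"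
    and M: "M > 0" and "global_in {1..n} M {p..critical_prob {1..n} f} f"
    and "mu {1..n} p f \<ge> exp (- M / 1000)"
  then have monotone: "monotone_boolean A f" and p_le: "p \<le> pc"
    and global: "global_in A M {p..pc} f" and mu_p: "exp (- M / 1000) \<le> mu A p f"
    by (simp_all add: A_def pc_def)
  have fin: "finite A" by (simp add: A_def)
  define F where "F X = f (\<lambda>i. i \<in> X)" for X
  have mono: "F Y" if "X \<subseteq> Y" "Y \<subseteq> A" "F X" for X Y
  proof -
    have "(\<lambda>i. i \<in> X) \<in> cube A" "(\<lambda>i. i \<in> Y) \<in> cube A"
      using that by (auto simp: cube_def PiE_dflt_def)
    with monotone have "f (\<lambda>i. i \<in> X) \<le> f (\<lambda>i. i \<in> Y)"
      using that(1) unfolding monotone_boolean_def by fastforce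
    with \<open>F X\<close> show ?thesis by (simp add: F_def)
  qed
  define m where "m q = expect A q (\<lambda>X. of_bool (F X))" for q
  have mu: "mu A q f = m q" if "q \<in> {0..1}" for q
    using that fin by (simp add: mu_eq_expect m_def F_def)
  let ?I = "\<lambda>q. influence A q (\<lambda>X. of_bool (F X))"
  have deriv: "(m has_real_derivative ?I q) (at q)" for q
    unfolding m_def by (rule Russo_formula[OF fin])
  have I_nonneg: "0 \<le> ?I q" if "q \<in> {0..1}" for q
    using that mono by (intro influence_nonneg) auto
  have pc_eq: "pc = Inf {q\<in>{0..1}. m q \<ge> 1/2}"
  proof -
    have "{q\<in>{0..1}. mu A q f \<ge> 1/2} = {q\<in>{0..1}. m q \<ge> 1/2}" using mu by auto
    then show ?thesis by (simp add: pc_def critical_prob_def)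
  qed
  have bdd: "bdd_below {q\<in>{0..1}. m q \<ge> 1/2}" by (intro bdd_belowI[of _ 0]) auto
  have pc_lower: "pc \<le> q" if "q \<in> {0..1}" "m q \<ge> 1/2" for q
    unfolding pc_eq using that bdd by (intro cInf_lower) auto
  have m_p: "exp (- M / 1000) \<le> m p" using mu_p mu p by simp
  then have m_p_pos: "0 < m p" using exp_gt_zero order_less_le_trans by blast
  \<comment> \<open>This excludes the constant 0, whose critical probability is unspecified, and
    puts 1 into the set whose infimum is \<open>pc\<close>.\<close>
  have "F A"
  proof (rule ccontr)
    assume "\<not> F A"
    then have "\<not> F X" if "X \<subseteq> A" for X using mono that by blast
    then have "m p = expect A p (\<lambda>_. 0)" unfolding m_def by (intro expect_cong) auto
    then show False using m_p_pos expect_const[OF fin] by simp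
  qed
  then have "pc \<le> 1"
    using pc_lower[of 1] by (simp add: m_def expect_1[OF fin])
  show "critical_prob {1..n} f \<le> M powr 1000 * p"
  \<comment> \<open>At \<open>p = 0\<close> the measure is concentrated on the empty set, so
    \<open>F {}\<close> holds and \<open>pc\<close> is at most 0. The main case needs
    \<open>ln p\<close>.\<close>
  proof (cases "p = 0")
    case True
    then have "F {}" using m_p_pos by (simp add: m_def expect_0[OF fin])
    then have "pc \<le> 0"
      using pc_lower[of 0] by (simp add: m_def expect_0[OF fin])
    then show ?thesis using True by (simp add: pc_def A_def)
  next
    case False
    then have p_pos: "0 < p" using p by simp
    then have unit: "q \<in> {0..1}" "0 < q" if "q \<in> {p..pc}" for q
      using that \<open>pc \<le> 1\<close> by auto
    \<comment> \<open>Below \<open>pc\<close> this is the definition of the infimum; at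
      \<open>pc\<close> itself it is a limit from the left. It keeps \<open>ln (m q)\<close> away
      from 0 on the whole interval.\<close>
    have m_half: "m q \<le> 1/2" if q: "q \<in> {p..pc}" for q
    proof (cases "q < pc")
      case True
      then show ?thesis using pc_lower[of q] unit[OF q] by force
    next
      case False
      then have q: "q = pc" using q by simp
      have "(m \<longlongrightarrow> m pc) (at_left pc)"
        using DERIV_isCont[OF deriv] by (simp add: isCont_def filterlim_at_split)
      moreover have "eventually (\<lambda>x. m x \<le> 1/2) (at_left pc)"
      proof (rule eventually_at_leftI)
        show "m x \<le> 1/2" if "x \<in> {0<..<pc}" for x
          using that pc_lower[of x] \<open>pc \<le> 1\<close> by force
        show "0 < pc" using p_pos p_le by simp
      qed
      ultimately show ?thesis unfolding q
        by (rule tendsto_upperbound) simp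
    qed
    have m_ge: "m p \<le> m q" if q: "q \<in> {p..pc}" for q
    proof (rule DERIV_nonneg_imp_nondecreasing[where f = m])
      show "p \<le> q" using q by simp
      fix x assume "p \<le> x" "x \<le> q"
      then have "0 \<le> ?I x" using I_nonneg unit q by auto
      then show "\<exists>y. DERIV m x :> y \<and> 0 \<le> y" using deriv by blast
    qed
    have ln_half: "ln (1/2 :: real) \<le> - 1/2"
      using ln_le_minus_one[of "1/2"] by simp
    have ln_m: "ln (m q) \<le> - 1/2" if q: "q \<in> {p..pc}" for q
    proof -
      have "0 < m q" using m_ge[OF q] m_p_pos by simp
      then have "ln (m q) \<le> ln (1/2)" using m_half[OF q] by (intro ln_mono) auto
      then show ?thesis using ln_half by linarith
    qed
    have infl: "- (m q * ln (m q)) / 1000 \<le> q * ?I q" if q: "q \<in> {p..pc}" for q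
      unfolding m_def
    proof (rule influence_lower_bound[OF fin], goal_cases)
      \<comment> \<open>The smallness hypothesis: globalness settles \<open>card R \<le> M\<close>,
        and the decay of \<open>(3 / 16) ^ card R\<close> settles larger \<open>R\<close>, where
        \<open>m q\<close> inherits the lower bound assumed at \<open>p\<close>.\<close>
      case (5 R)
      let ?E = "expect (A - R) q (\<lambda>X. of_bool (F (X \<union> R)))"
      have E: "0 \<le> ?E" "?E \<le> 1"
        using unit[OF q] fin expect_mono[of q "A - R" "\<lambda>X. of_bool (F (X \<union> R))" "\<lambda>_. 1"]
        by (auto intro!: expect_nonneg simp: expect_const)
      have "(3 / 16) ^ card R * ?E \<le> m q powr 0.01"
      proof (cases "real (card R) \<le> M")
        case True
        have "mu (A - R) q (set_ones R f) \<le> mu A q f powr 0.01"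
          using global True 5 q unfolding global_in_def by blast
        then have "?E \<le> m q powr 0.01"
          using mu[OF unit(1)[OF q]] unit[OF q] fin by (simp add: mu_set_ones_eq_expect F_def)
        moreover have "(3 / 16) ^ card R * ?E \<le> ?E"
          using E by (intro mult_left_le_one_le) (auto simp: power_le_one)
        ultimately show ?thesis by linarith
      next
        case False
        then have "(3 / 16) ^ card R \<le> m q powr 0.01"
          using M m_p m_ge[OF q] by (intro three_sixteenths_power_le[of M]) auto
        moreover have "(3 / 16) ^ card R * ?E \<le> (3 / 16) ^ card R"
          using E by (intro mult_left_le) auto
        ultimately show ?thesis by linarith
      qed
      then show ?case by (simp add: m_def)
    qed (use unit[OF q] mono m_ge[OF q] m_p_pos in \<open>auto simp: m_def\<close>)
    \<comment> \<open>The bound \<open>infl\<close> says that the derivative of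
      \<open>ln (- ln (m q))\<close> is at most \<open>- 1 / (1000 * q)\<close>, which the term
      \<open>ln q / 1000\<close> compensates.\<close>
    define \<Phi> where "\<Phi> q = ln (- ln (m q)) + ln q / 1000" for q
    have "\<Phi> pc \<le> \<Phi> p"
    proof (rule DERIV_nonpos_imp_nonincreasing[OF p_le])
      fix q assume "p \<le> q" "q \<le> pc"
      then have q: "q \<in> {p..pc}" by simp
      have pos: "0 < m q" "0 < q" "ln (m q) < 0"
        using m_ge[OF q] m_p_pos unit[OF q] m_half[OF q] by auto
      have "(\<Phi> has_real_derivative ?I q / (m q * ln (m q)) + 1 / (1000 * q)) (at q)"
        unfolding \<Phi>_def using pos
        by (auto intro!: derivative_eq_intros deriv simp: field_simps)
      moreover have "?I q / (m q * ln (m q)) + 1 / (1000 * q) \<le> 0"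
      proof -
        \<comment> \<open>The denominator \<open>m q * ln (m q)\<close> is negative; its negation
          allows division without reversing the inequality.\<close>
        define u where "u = - (m q * ln (m q))"
        have "0 < u" using pos by (simp add: u_def mult_pos_neg)
        moreover have "u / 1000 \<le> q * ?I q" using infl[OF q] by (simp add: u_def)
        ultimately have "1 / (1000 * q) \<le> ?I q / u" using pos by (simp add: field_simps)
        then show ?thesis by (simp add: u_def)
      qed
      ultimately show "\<exists>y. DERIV \<Phi> q :> y \<and> y \<le> 0" by blast
    qed
    moreover have "- ln 2 \<le> ln (- ln (m pc))"
    proof -
      have "ln (1/2) \<le> ln (- ln (m pc))"
        using ln_m[of pc] p_le by (intro ln_mono) auto
      then show ?thesis by (simp add: ln_div)
    qed
    moreover have "ln (- ln (m p)) \<le> ln M - ln 1000"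
    proof -
      have "- ln (m p) \<le> M / 1000"
        using ln_mono[OF m_p] by simp
      then have "ln (- ln (m p)) \<le> ln (M / 1000)"
        using ln_m[of p] p_le by (intro ln_mono) auto
      then show ?thesis using M by (simp add: ln_div)
    qed
    \<comment> \<open>The \<open>ln 1000\<close> gained from the lower bound at \<open>p\<close>
      absorbs the \<open>ln 2\<close> lost at \<open>pc\<close>, so no constant factor is left
      over.\<close>
    moreover have "ln 2 \<le> ln (1000::real)" by simp
    ultimately have "ln pc \<le> 1000 * ln M + ln p" unfolding \<Phi>_def by argo
    then have "exp (ln pc) \<le> exp (1000 * ln M + ln p)" by simp
    then have "pc \<le> M powr 1000 * p"
      using p_pos p_le M by (simp add: exp_add powr_def)
    then show ?thesis by (simp add: pc_def A_def)
  qed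
qed simp

end
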